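(* Let $\mathbb{K}$ be a (commutative) integral domain with field of fractions $\mathbb{F}$, let $\Sigma$ be a finite alphabet, and let $(\lambda,\mu,\gamma)$ be a linear representation of dimension $n$ over $\mathbb{K}$ and $\Sigma$. Suppose that a run of Algorithm prefix (described in the context) on input $(\lambda,\mu,\gamma)$ terminates, and let $(X,Z)$ be its output. Then: 1. the family $\lambda\mu(X)=(\lambda\mu(x))_{x\in X}$ generates the $\mathbb{K}$-module $\lambda\mu(\mathbb{K}\langle\Sigma\rangle)$; 2. the family $\lambda\mu(X\setminus Z)=(\lambda\mu(x))_{x\in X\setminus Z}$ is linearly independent over $\mathbb{F}$.
   Context: A linear representation of dimension $n$ over $\mathbb{K}$ and $\Sigma$ is a triple $(\lambda,\mu,\gamma)$ with $\lambda\in\mathbb{K}^{1\times n}$, $\gamma\in\mathbb{K}^{n\times 1}$ and $\mu:\Sigma^*\to\mathbb{K}^{n\times n}$ a monoid morphism from the free monoid $\Sigma^*$ (with empty word $1$) to the multiplicative monoid of $n\times n$ matrices. The map $\mu$ is extended $\mathbb{K}$-linearly to the algebra $\mathbb{K}\langle\Sigma\rangle$ of noncommutative polynomials, and $\lambda\mu(\mathbb{K}\langle\Sigma\rangle)=\{\lambda\mu(P): P\in\mathbb{K}\langle\Sigma\rangle\}\subseteq\mathbb{K}^{1\times n}$. Algorithm prefix maintains a triple $(X,Y,Z)$ of finite sets of words, initialized as $(\emptyset,\{1\},\emptyset)$. While $Y\neq\emptyset$, it chooses a word $y\in Y$ of minimal length (arbitrarily among those of minimal length) and updates the triple as follows,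 where at that moment $X=\{x_1,\dots,x_k\}$. (i) If there is no relation $\alpha\,\lambda\mu(y)=\alpha_1\lambda\mu(x_1)+\cdots+\alpha_k\lambda\mu(x_k)$ with $\alpha\in\mathbb{K}\setminus\{0\}$ and $\alpha_1,\dots,\alpha_k\in\mathbb{K}$, then $(X,Y,Z)$ is replaced by $(X\cup\{y\},(Y\cup y\Sigma)\setminus\{y\},Z)$, where $y\Sigma=\{ya: a\in\Sigma\}$. (ii) Otherwise, if there is such a relation in which $\alpha$ divides every $\alpha_i$ ($1\le i\le k$) in $\mathbb{K}$, then $(X,Y,Z)$ is replaced by $(X,Y\setminus\{y\},Z)$. (iii) Otherwise, $(X,Y,Z)$ is replaced by $(X\cup\{y\},(Y\cup y\Sigma)\setminus\{y\},Z\cup\{y\})$. The algorithm terminates when $Y=\emptyset$ and then outputs the pair $(X,Z)$. When $k=0$, the empty sum is $0$. *)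

theory Defs
  imports
    "Jordan_Normal_Form.VS_Connect"
    "HOL-Library.Poly_Mapping"
    "HOL-Computational_Algebra.Polynomial_Factorial"
begin

text \<open>Words over the alphabet \<open>\<Sigma>\<close> are the elements of \<^term>\<open>lists \<Sigma>\<close>; the values of \<open>\<mu>\<close> on
  lists that are not words over \<open>\<Sigma>\<close> are unconstrained and never used. The dimension \<open>n\<close> may be 0.\<close>

locale linear_representation =
  fixes n :: nat
    and \<Sigma> :: "'b set"
    and lam :: "'a :: idom mat"
    and \<mu> :: "'b list \<Rightarrow> 'a mat"
    and \<gamma> :: "'a mat"
  assumes lam_carrier: "lam \<in> carrier_mat 1 n"
    and mu_carrier: "w \<in> lists \<Sigma> \<Longrightarrow> \<mu> w \<in> carrier_mat n n"
    and mu_Nil: "\<mu> [] = 1\<^sub>m n"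
    and mu_append: "u \<in> lists \<Sigma> \<Longrightarrow> v \<in> lists \<Sigma> \<Longrightarrow> \<mu> (u @ v) = \<mu> u * \<mu> v"
    and gamma_carrier: "\<gamma> \<in> carrier_mat n 1"

text \<open>Noncommutative polynomials are finitely supported functions from words to coefficients. Only
  their module structure is needed here, so their product is not defined.\<close>

definition nc_polys :: "'b set \<Rightarrow> ('b list \<Rightarrow>\<^sub>0 'a :: zero) set" where
  "nc_polys \<Sigma> = {P. Poly_Mapping.keys P \<subseteq> lists \<Sigma>}"

definition linear_ext :: "nat \<Rightarrow> ('b list \<Rightarrow> 'a :: idom mat) \<Rightarrow> ('b list \<Rightarrow>\<^sub>0 'a) \<Rightarrow> 'a mat" where
  "linear_ext n \<mu> P = (\<Oplus>\<^bsub>module_mat TYPE('a) n n\<^esub> w \<in> Poly_Mapping.keys P. Poly_Mapping.lookup P w \<cdot>\<^sub>m \<mu> w)"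

definition prefix_module ::
  "nat \<Rightarrow> 'b set \<Rightarrow> 'a :: idom mat \<Rightarrow> ('b list \<Rightarrow> 'a mat) \<Rightarrow> 'a mat set" where
  "prefix_module n \<Sigma> lam \<mu> = {lam * linear_ext n \<mu> P | P. P \<in> nc_polys \<Sigma>}"

text \<open>The relation \<open>\<alpha> \<lambda>\<mu>(y) = \<alpha>\<^sub>1 \<lambda>\<mu>(x\<^sub>1) + \<dots> + \<alpha>\<^sub>k \<lambda>\<mu>(x\<^sub>k)\<close> for
  \<open>X = {x\<^sub>1, \<dots>, x\<^sub>k}\<close>, where \<open>\<alpha>\<^sub>i = c x\<^sub>i\<close>.\<close>

definition row_relation ::
  "nat \<Rightarrow> 'a :: idom mat \<Rightarrow> ('b list \<Rightarrow> 'a mat) \<Rightarrow> 'b list set \<Rightarrow> 'b list \<Rightarrow> 'a \<Rightarrow> ('b list \<Rightarrow> 'a) \<Rightarrow> bool"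
where
  "row_relation n lam \<mu> X y \<alpha> c \<longleftrightarrow>
     \<alpha> \<cdot>\<^sub>m (lam * \<mu> y) = (\<Oplus>\<^bsub>module_mat TYPE('a) 1 n\<^esub> x \<in> X. c x \<cdot>\<^sub>m (lam * \<mu> x))"

definition has_relation ::
  "nat \<Rightarrow> 'a :: idom mat \<Rightarrow> ('b list \<Rightarrow> 'a mat) \<Rightarrow> 'b list set \<Rightarrow> 'b list \<Rightarrow> bool" where
  "has_relation n lam \<mu> X y \<longleftrightarrow> (\<exists>\<alpha> c. \<alpha> \<noteq> 0 \<and> row_relation n lam \<mu> X y \<alpha> c)"

definition has_divisible_relation ::
  "nat \<Rightarrow> 'a :: idom mat \<Rightarrow> ('b list \<Rightarrow> 'a mat) \<Rightarrow> 'b list set \<Rightarrow> 'b list \<Rightarrow> bool" where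
  "has_divisible_relation n lam \<mu> X y \<longleftrightarrow>
     (\<exists>\<alpha> c. \<alpha> \<noteq> 0 \<and> row_relation n lam \<mu> X y \<alpha> c \<and> (\<forall>x\<in>X. \<alpha> dvd c x))"

text \<open>One iteration of the loop. It is a relation rather than a function because of the arbitrary
  choice of \<open>y\<close> among the words of minimal length in \<open>Y\<close>.\<close>

inductive prefix_step ::
  "nat \<Rightarrow> 'b set \<Rightarrow> 'a :: idom mat \<Rightarrow> ('b list \<Rightarrow> 'a mat) \<Rightarrow>
     'b list set \<times> 'b list set \<times> 'b list set \<Rightarrow> 'b list set \<times> 'b list set \<times> 'b list set \<Rightarrow> bool"
  for n :: nat and \<Sigma> :: "'b set" and lam :: "'a mat" and \<mu> :: "'b list \<Rightarrow> 'a mat"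
where
  independent:
    "\<lbrakk>y \<in> Y; \<forall>y'\<in>Y. length y \<le> length y';
      \<not> has_relation n lam \<mu> X y\<rbrakk> \<Longrightarrow>
     prefix_step n \<Sigma> lam \<mu> (X, Y, Z)
       (X \<union> {y}, (Y \<union> (\<lambda>a. y @ [a]) ` \<Sigma>) - {y}, Z)"
| divisible:
    "\<lbrakk>y \<in> Y; \<forall>y'\<in>Y. length y \<le> length y';
      has_relation n lam \<mu> X y; has_divisible_relation n lam \<mu> X y\<rbrakk> \<Longrightarrow>
     prefix_step n \<Sigma> lam \<mu> (X, Y, Z) (X, Y - {y}, Z)"
| dependent:
    "\<lbrakk>y \<in> Y; \<forall>y'\<in>Y. length y \<le> length y';
      has_relation n lam \<mu> X y; \<not> has_divisible_relation n lam \<mu> X y\<rbrakk> \<Longrightarrow>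
     prefix_step n \<Sigma> lam \<mu> (X, Y, Z)
       (X \<union> {y}, (Y \<union> (\<lambda>a. y @ [a]) ` \<Sigma>) - {y}, Z \<union> {y})"

definition prefix_output ::
  "nat \<Rightarrow> 'b set \<Rightarrow> 'a :: idom mat \<Rightarrow> ('b list \<Rightarrow> 'a mat) \<Rightarrow> 'b list set \<Rightarrow> 'b list set \<Rightarrow> bool" where
  "prefix_output n \<Sigma> lam \<mu> X Z \<longleftrightarrow>
     (prefix_step n \<Sigma> lam \<mu>)\<^sup>*\<^sup>* ({}, {[]}, {}) (X, {}, Z)"

definition row_span :: "nat \<Rightarrow> 'a :: comm_ring_1 mat set \<Rightarrow> 'a mat set" where
  "row_span n S = LinearCombinations.module.span class_ring (module_mat TYPE('a) 1 n) S"

text \<open>Independence of a family, so that a repeated row counts as a dependency (which the set-based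
  \<open>lin_indpt\<close> would not detect).\<close>

definition row_indep_family :: "nat \<Rightarrow> ('i \<Rightarrow> 'f :: field mat) \<Rightarrow> 'i set \<Rightarrow> bool" where
  "row_indep_family n v I \<longleftrightarrow>
     (\<forall>J c. finite J \<and> J \<subseteq> I \<and> (\<Oplus>\<^bsub>module_mat TYPE('f) 1 n\<^esub> i \<in> J. c i \<cdot>\<^sub>m v i) = 0\<^sub>m 1 n
       \<longrightarrow> (\<forall>i\<in>J. c i = 0))"

end

theory Submission
  imports Defs
begin

text \<open>
  Write \<open>r w\<close> for the row \<open>\<lambda>\<mu>(w)\<close>. Both claims are read off an invariant of the loop
  (\<open>prefix_invariant\<close>), which says of the current triple \<open>(X, Y, Z)\<close> that
  \<^item> the family \<open>r\<close> is independent on \<open>X - Z\<close>, and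
  \<^item> the empty word and every one-letter extension \<open>xa\<close> of a word \<open>x \<in> X\<close> either still waits in \<open>Y\<close> or
    has its row in the span of \<open>r(X)\<close>.

  \<^noindent> The first part survives because a word enters \<open>X\<close> without entering \<open>Z\<close> only if no nonzero
  multiple of its row is a combination of rows of \<open>X\<close> (\<open>row_indep_dom_insert\<close>). The second part
  survives because a word that leaves \<open>Y\<close> has its row in the span: either it joins \<open>X\<close>, or it is
  discarded because of a relation whose leading coefficient \<open>\<alpha>\<close> divides all the others, and then
  \<open>\<alpha>\<close> can be cancelled in a domain (\<open>row_in_span_if_divisible\<close>). New words in \<open>X\<close> put their
  extensions into \<open>Y\<close>.

  When \<open>Y\<close> is empty, the second part says that the span of \<open>r(X)\<close> contains \<open>r(1) = \<lambda>\<close> and is stable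
  under right multiplication by each \<open>\<mu>(a)\<close>. Hence it contains the row of every word, and so the
  whole module \<open>\<lambda>\<mu>(\<K>\<langle>\<Sigma>\<rangle>)\<close>, which is spanned by these rows (\<open>row_span_eq_prefix_moduleI\<close>). The first
  part gives independence over the domain; multiplying a relation over the field of fractions by a
  common denominator gives independence there (\<open>row_indep_family_fract\<close>).
\<close>

section \<open>Matrices as a module\<close>

lemma module_mat_is_module:
  "module (class_ring :: 'a :: comm_ring_1 ring) (module_mat TYPE('a) nr nc)"
proof -
  interpret abelian_group "module_mat TYPE('a) nr nc"
    by (rule abelian_group_mat)
  show ?thesis
    by unfold_locales
      (auto simp: matrix_vs_simps add_smult_distrib_left_mat add_smult_distrib_right_mat
        ac_simps)
qed

lemma finsum_mat_carrier:
  fixes f :: "'i \<Rightarrow> 'a :: comm_ring_1 mat"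
  assumes "\<And>x. x \<in> A \<Longrightarrow> f x \<in> carrier_mat nr nc"
  shows "finsum (module_mat TYPE('a) nr nc) f A \<in> carrier_mat nr nc"
proof -
  interpret abelian_group "module_mat TYPE('a) nr nc"
    by (rule abelian_group_mat)
  show ?thesis
    using finsum_closed[of f A] assms by (auto simp: module_mat_simps)
qed

lemma finsum_mat_index:
  fixes f :: "'i \<Rightarrow> 'a :: comm_ring_1 mat"
  assumes "finite A" and "\<And>x. x \<in> A \<Longrightarrow> f x \<in> carrier_mat nr nc"
    and "i < nr" and "j < nc"
  shows "finsum (module_mat TYPE('a) nr nc) f A $$ (i, j) = (\<Sum>x\<in>A. f x $$ (i, j))"
proof -
  interpret abelian_group "module_mat TYPE('a) nr nc"
    by (rule abelian_group_mat)
  show ?thesis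
    using assms(1,2)
  proof (induction A rule: finite_induct)
    case empty
    then show ?case
      using assms(3,4) finsum_empty by (simp add: module_mat_simps)
  next
    case (insert x A)
    have "finsum (module_mat TYPE('a) nr nc) f A \<in> carrier_mat nr nc"
      using insert.prems by (intro finsum_mat_carrier) auto
    moreover have "finsum (module_mat TYPE('a) nr nc) f (insert x A)
        = f x + finsum (module_mat TYPE('a) nr nc) f A"
      using finsum_insert[of A x f] insert by (auto simp: module_mat_simps)
    ultimately show ?case
      using insert assms(3,4) by simp
  qed
qed

text \<open>Sums in the module of matrices are abstract monoid sums; comparing entries turns every identity
  about them into one about ordinary sums of ring elements.\<close>

lemma eq_finsum_mat_iff:
  fixes f :: "'i \<Rightarrow> 'a :: comm_ring_1 mat"
  assumes "finite A" and "\<And>x. x \<in> A \<Longrightarrow> f x \<in> carrier_mat nr nc"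
    and "M \<in> carrier_mat nr nc"
  shows "M = finsum (module_mat TYPE('a) nr nc) f A
    \<longleftrightarrow> (\<forall>i<nr. \<forall>j<nc. M $$ (i, j) = (\<Sum>x\<in>A. f x $$ (i, j)))"
  using finsum_mat_carrier[of A f nr nc, OF assms(2)] assms(3)
  by (auto simp: finsum_mat_index assms(1,2) intro!: eq_matI)

lemma mult_finsum_mat:
  fixes f :: "'i \<Rightarrow> 'a :: comm_ring_1 mat"
  assumes "finite A" and "\<And>x. x \<in> A \<Longrightarrow> f x \<in> carrier_mat m k" and "L \<in> carrier_mat l m"
  shows "L * finsum (module_mat TYPE('a) m k) f A
    = finsum (module_mat TYPE('a) l k) (\<lambda>x. L * f x) A"
proof -
  let ?S = "finsum (module_mat TYPE('a) m k) f A"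
  have S: "?S \<in> carrier_mat m k"
    using assms(2) by (rule finsum_mat_carrier)
  have prod_index: "(L * M) $$ (i, j) = (\<Sum>t<m. L $$ (i, t) * M $$ (t, j))"
    if "M \<in> carrier_mat m k" "i < l" "j < k" for M i j
    using that assms(3) by (simp add: scalar_prod_def atLeast0LessThan)
  have "(L * ?S) $$ (i, j) = (\<Sum>x\<in>A. (L * f x) $$ (i, j))" if ij: "i < l" "j < k" for i j
  proof -
    have "(L * ?S) $$ (i, j) = (\<Sum>t<m. \<Sum>x\<in>A. L $$ (i, t) * f x $$ (t, j))"
      by (simp add: prod_index[OF S ij] finsum_mat_index[OF assms(1,2)] ij sum_distrib_left)
    also have "\<dots> = (\<Sum>x\<in>A. \<Sum>t<m. L $$ (i, t) * f x $$ (t, j))"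
      by (rule sum.swap)
    also have "\<dots> = (\<Sum>x\<in>A. (L * f x) $$ (i, j))"
      by (intro sum.cong refl prod_index[symmetric] assms(2) ij)
    finally show ?thesis .
  qed
  moreover have "L * f x \<in> carrier_mat l k" if "x \<in> A" for x
    using assms(2)[OF that] assms(3) by simp
  ultimately show ?thesis
    using S assms(1,3) by (subst eq_finsum_mat_iff) simp_all
qed

lemma smult_mat_index:
  "A \<in> carrier_mat nr nc \<Longrightarrow> i < nr \<Longrightarrow> j < nc \<Longrightarrow> (c \<cdot>\<^sub>m A) $$ (i, j) = c * A $$ (i, j)"
  by auto

lemma row_eqI:
  assumes "A \<in> carrier_mat 1 n" and "B \<in> carrier_mat 1 n"
    and "\<And>k. k < n \<Longrightarrow> A $$ (0, k) = B $$ (0, k)"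
  shows "A = B"
  using assms by (intro eq_matI) (metis carrier_matD less_one)+

lemma submodule_matI:
  fixes N :: "'a :: comm_ring_1 mat set"
  assumes "N \<subseteq> carrier_mat nr nc" and "0\<^sub>m nr nc \<in> N"
    and "\<And>v w. v \<in> N \<Longrightarrow> w \<in> N \<Longrightarrow> v + w \<in> N" and "\<And>c v. v \<in> N \<Longrightarrow> c \<cdot>\<^sub>m v \<in> N"
  shows "submodule class_ring N (module_mat TYPE('a) nr nc)"
  using assms module_mat_is_module
  by (auto simp: submodule_def matrix_vs_simps)

lemma submodule_matD:
  fixes N :: "'a :: comm_ring_1 mat set"
  assumes "submodule class_ring N (module_mat TYPE('a) nr nc)"
  shows "N \<subseteq> carrier_mat nr nc" and "0\<^sub>m nr nc \<in> N"
    and "v \<in> N \<Longrightarrow> w \<in> N \<Longrightarrow> v + w \<in> N" and "v \<in> N \<Longrightarrow> c \<cdot>\<^sub>m v \<in> N"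
  using assms by (auto simp: submodule_def matrix_vs_simps)

lemma finsum_mat_in_submodule:
  fixes N :: "'a :: comm_ring_1 mat set"
  assumes N: "submodule class_ring N (module_mat TYPE('a) nr nc)"
    and "finite A" and "\<And>x. x \<in> A \<Longrightarrow> f x \<in> N"
  shows "finsum (module_mat TYPE('a) nr nc) f A \<in> N"
proof -
  interpret abelian_group "module_mat TYPE('a) nr nc"
    by (rule abelian_group_mat)
  note D = submodule_matD[OF N]
  show ?thesis
    using assms(2,3)
  proof (induction A rule: finite_induct)
    case empty
    then show ?case
      using D(2) finsum_empty by (simp add: module_mat_simps)
  next
    case (insert x A)
    have "f \<in> insert x A \<rightarrow> carrier_mat nr nc"
      using insert.prems D(1) by blast
    then have "finsum (module_mat TYPE('a) nr nc) f (insert x A)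
        = f x + finsum (module_mat TYPE('a) nr nc) f A"
      using finsum_insert[of A x f] insert.hyps by (simp add: module_mat_simps)
    then show ?case
      using insert D(3) by simp
  qed
qed

lemma submodule_row_span:
  fixes S :: "'a :: comm_ring_1 mat set"
  assumes "S \<subseteq> carrier_mat 1 n"
  shows "submodule class_ring (row_span n S) (module_mat TYPE('a) 1 n)"
  unfolding row_span_def
  using module.span_is_submodule[OF module_mat_is_module] assms by (simp add: module_mat_simps)

lemma row_span_superset:
  "S \<subseteq> carrier_mat 1 n \<Longrightarrow> S \<subseteq> row_span n S"
  unfolding row_span_def
  using module.in_own_span[OF module_mat_is_module, of S 1 n] by (simp add: module_mat_simps)

lemma row_span_least:
  fixes S N :: "'a :: comm_ring_1 mat set"
  assumes "S \<subseteq> N" and "submodule class_ring N (module_mat TYPE('a) 1 n)"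
  shows "row_span n S \<subseteq> N"
  unfolding row_span_def
  by (rule module.span_is_subset[OF module_mat_is_module assms])

lemma row_span_mono: "S \<subseteq> T \<Longrightarrow> row_span n S \<subseteq> row_span n T"
  unfolding row_span_def
  by (rule module.span_is_monotone[OF module_mat_is_module])

section \<open>Independence over the domain and over its field of fractions\<close>

text \<open>The analogue of \<^const>\<open>row_indep_family\<close> with coefficients in the domain, stated on entries so
  that relations can be rearranged and scaled as identities of ring elements.\<close>

definition row_indep_dom :: "nat \<Rightarrow> ('i \<Rightarrow> 'a :: idom mat) \<Rightarrow> 'i set \<Rightarrow> bool" where
  "row_indep_dom n v I \<longleftrightarrow>
     (\<forall>J c. finite J \<and> J \<subseteq> I \<and> (\<forall>k<n. (\<Sum>i\<in>J. c i * v i $$ (0, k)) = 0) \<longrightarrow> (\<forall>i\<in>J. c i = 0))"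

lemma row_indep_dom_subset: "row_indep_dom n v I \<Longrightarrow> I' \<subseteq> I \<Longrightarrow> row_indep_dom n v I'"
  unfolding row_indep_dom_def by (meson subset_trans)

lemma common_denominator:
  fixes c :: "'i \<Rightarrow> 'a :: idom fract"
  assumes "finite J"
  shows "\<exists>d a. d \<noteq> 0 \<and> (\<forall>i\<in>J. to_fract d * c i = to_fract (a i))"
  using assms
proof (induction J rule: finite_induct)
  case empty
  show ?case by (intro exI[of _ 1]) auto
next
  case (insert x J)
  then obtain d a where d: "d \<noteq> 0" "\<forall>i\<in>J. to_fract d * c i = to_fract (a i)"
    by blast
  obtain p q where q: "c x = Fract p q" "q \<noteq> 0"
    by (cases "c x") auto
  let ?a = "\<lambda>i. if i = x then d * p else q * a i"
  have "to_fract (d * q) * c i = to_fract (?a i)" if "i \<in> insert x J" for i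
  proof (cases "i = x")
    case True
    then show ?thesis
      using q by (simp add: Fract_conv_to_fract)
  next
    case False
    then have "to_fract d * c i = to_fract (a i)"
      using that d by auto
    then show ?thesis
      using False by (simp add: ac_simps)
  qed
  moreover have "d * q \<noteq> 0"
    using d q by simp
  ultimately show ?case
    by (intro exI[of _ "d * q"] exI[of _ ?a] conjI ballI)
qed

text \<open>A relation over the field of fractions, multiplied by a common denominator of its coefficients,
  becomes a relation over the domain whose coefficients vanish exactly where the original ones do.\<close>

lemma row_indep_family_fract:
  fixes v :: "'i \<Rightarrow> 'a :: idom mat"
  assumes v: "\<And>i. i \<in> I \<Longrightarrow> v i \<in> carrier_mat 1 n" and "row_indep_dom n v I"
  shows "row_indep_family n (\<lambda>i. map_mat to_fract (v i) :: 'a fract mat) I"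
  unfolding row_indep_family_def
proof (intro allI impI, elim conjE)
  fix J and c :: "'i \<Rightarrow> 'a fract"
  assume J: "finite J" "J \<subseteq> I"
    and rel: "(\<Oplus>\<^bsub>module_mat TYPE('a fract) 1 n\<^esub> i \<in> J. c i \<cdot>\<^sub>m map_mat to_fract (v i)) = 0\<^sub>m 1 n"
  obtain d a where d: "d \<noteq> 0" and a: "\<And>i. i \<in> J \<Longrightarrow> to_fract d * c i = to_fract (a i)"
    using common_denominator[OF J(1), of c] by blast
  have vJ: "v i \<in> carrier_mat 1 n" if "i \<in> J" for i
    using v J that by auto
  have "(\<Sum>i\<in>J. a i * v i $$ (0, k)) = 0" if k: "k < n" for k
  proof -
    have "0 = (\<Sum>i\<in>J. (c i \<cdot>\<^sub>m map_mat to_fract (v i)) $$ (0, k))"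
      using finsum_mat_index[OF J(1), of "\<lambda>i. c i \<cdot>\<^sub>m map_mat to_fract (v i)" 1 n 0 k] vJ k rel
      by simp
    also have "\<dots> = (\<Sum>i\<in>J. c i * to_fract (v i $$ (0, k)))"
    proof (intro sum.cong refl)
      fix i assume "i \<in> J"
      then show "(c i \<cdot>\<^sub>m map_mat to_fract (v i)) $$ (0, k) = c i * to_fract (v i $$ (0, k))"
        using vJ[of i] k by (subst smult_mat_index[of _ 1 n]) auto
    qed
    finally have "0 = to_fract d * (\<Sum>i\<in>J. c i * to_fract (v i $$ (0, k)))"
      by simp
    also have "\<dots> = (\<Sum>i\<in>J. to_fract (a i) * to_fract (v i $$ (0, k)))"
      by (simp add: sum_distrib_left a flip: mult.assoc)
    also have "\<dots> = to_fract (\<Sum>i\<in>J. a i * v i $$ (0, k))"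
      by simp
    finally show ?thesis
      by (metis to_fract_eq_0_iff)
  qed
  then have "\<forall>i\<in>J. a i = 0"
    using assms(2) J unfolding row_indep_dom_def by blast
  then show "\<forall>i\<in>J. c i = 0"
    using a d by (metis mult_eq_0_iff to_fract_eq_0_iff)
qed

section \<open>The rows of a linear representation\<close>

context linear_representation
begin

abbreviation row_of :: "'b list \<Rightarrow> 'a mat" where
  "row_of w \<equiv> lam * \<mu> w"

lemma row_of_carrier: "w \<in> lists \<Sigma> \<Longrightarrow> row_of w \<in> carrier_mat 1 n"
  using lam_carrier mu_carrier by auto

lemma rows_carrier: "X \<subseteq> lists \<Sigma> \<Longrightarrow> row_of ` X \<subseteq> carrier_mat 1 n"
  using row_of_carrier by blast

lemma row_of_snoc:
  assumes "w \<in> lists \<Sigma>" and "a \<in> \<Sigma>"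
  shows "row_of (w @ [a]) = row_of w * \<mu> [a]"
  using assms lam_carrier mu_carrier[of w] mu_carrier[of "[a]"]
  by (simp add: mu_append[of w "[a]"])

lemma row_relation_iff:
  assumes "finite X" and "X \<subseteq> lists \<Sigma>" and "y \<in> lists \<Sigma>"
  shows "row_relation n lam \<mu> X y \<alpha> c \<longleftrightarrow>
    (\<forall>k<n. \<alpha> * row_of y $$ (0, k) = (\<Sum>x\<in>X. c x * row_of x $$ (0, k)))"
proof -
  have X: "row_of x \<in> carrier_mat 1 n" if "x \<in> X" for x
    using assms that by (intro row_of_carrier) auto
  have y: "row_of y \<in> carrier_mat 1 n"
    using assms by (intro row_of_carrier)
  have *: "(\<Sum>x\<in>X. (c x \<cdot>\<^sub>m row_of x) $$ (0, k)) = (\<Sum>x\<in>X. c x * row_of x $$ (0, k))"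
    if "k < n" for k
    by (intro sum.cong refl smult_mat_index[OF X _ that]) simp_all
  have **: "(\<alpha> \<cdot>\<^sub>m row_of y) $$ (0, k) = \<alpha> * row_of y $$ (0, k)" if "k < n" for k
    by (intro smult_mat_index[OF y _ that]) simp
  show ?thesis
    unfolding row_relation_def
    by (subst eq_finsum_mat_iff[OF assms(1)])
      (use X y * ** in \<open>auto simp del: index_smult_mat index_mult_mat\<close>)
qed

lemma lam_linear_ext:
  assumes "P \<in> nc_polys \<Sigma>"
  shows "lam * linear_ext n \<mu> P
    = (\<Oplus>\<^bsub>module_mat TYPE('a) 1 n\<^esub> w \<in> Poly_Mapping.keys P. Poly_Mapping.lookup P w \<cdot>\<^sub>m row_of w)"
proof -
  let ?K = "Poly_Mapping.keys P" and ?c = "Poly_Mapping.lookup P"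
  have K: "\<mu> w \<in> carrier_mat n n" if "w \<in> ?K" for w
    using assms that mu_carrier unfolding nc_polys_def by blast
  have "lam * linear_ext n \<mu> P
      = (\<Oplus>\<^bsub>module_mat TYPE('a) 1 n\<^esub> w \<in> ?K. lam * (?c w \<cdot>\<^sub>m \<mu> w))"
    unfolding linear_ext_def using K lam_carrier by (intro mult_finsum_mat) auto
  also have "\<dots> = (\<Oplus>\<^bsub>module_mat TYPE('a) 1 n\<^esub> w \<in> ?K. ?c w \<cdot>\<^sub>m row_of w)"
  proof -
    interpret abelian_group "module_mat TYPE('a) 1 n"
      by (rule abelian_group_mat)
    show ?thesis
      using K lam_carrier
      by (intro finsum_cong')
        (auto simp: module_mat_simps intro!: mult_smult_distrib[of _ 1 n _ n])
  qed
  finally show ?thesis .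
qed

lemma lam_linear_ext_carrier:
  "P \<in> nc_polys \<Sigma> \<Longrightarrow> lam * linear_ext n \<mu> P \<in> carrier_mat 1 n"
  unfolding lam_linear_ext
  by (intro finsum_mat_carrier smult_carrier_mat row_of_carrier) (auto simp: nc_polys_def)

text \<open>Letting the sum range over any finite superset \<open>W\<close> of the support allows polynomials with different
  supports to be added term by term.\<close>

lemma lam_linear_ext_index:
  assumes "P \<in> nc_polys \<Sigma>" and "finite W" and "Poly_Mapping.keys P \<subseteq> W" and "k < n"
  shows "(lam * linear_ext n \<mu> P) $$ (0, k) = (\<Sum>w\<in>W. Poly_Mapping.lookup P w * row_of w $$ (0, k))"
proof -
  let ?K = "Poly_Mapping.keys P" and ?c = "Poly_Mapping.lookup P"
  have K: "row_of w \<in> carrier_mat 1 n" if "w \<in> ?K" for w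
    using assms that row_of_carrier unfolding nc_polys_def by blast
  have "(lam * linear_ext n \<mu> P) $$ (0, k) = (\<Sum>w\<in>?K. (?c w \<cdot>\<^sub>m row_of w) $$ (0, k))"
    unfolding lam_linear_ext[OF assms(1)]
    by (intro finsum_mat_index smult_carrier_mat K) (use assms in auto)
  also have "\<dots> = (\<Sum>w\<in>?K. ?c w * row_of w $$ (0, k))"
    by (intro sum.cong refl smult_mat_index[OF K _ assms(4)]) simp_all
  also have "\<dots> = (\<Sum>w\<in>W. ?c w * row_of w $$ (0, k))"
    using assms by (intro sum.mono_neutral_left) (auto simp: in_keys_iff)
  finally show ?thesis .
qed

lemma submodule_prefix_module:
  "submodule class_ring (prefix_module n \<Sigma> lam \<mu>) (module_mat TYPE('a) 1 n)"
proof (rule submodule_matI)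
  let ?N = "prefix_module n \<Sigma> lam \<mu>"
  show "?N \<subseteq> carrier_mat 1 n"
    using lam_linear_ext_carrier by (auto simp: prefix_module_def)
  have zero: "0 \<in> nc_polys \<Sigma>"
    by (simp add: nc_polys_def)
  have "lam * linear_ext n \<mu> 0 = 0\<^sub>m 1 n"
    using lam_linear_ext_carrier[OF zero] lam_linear_ext_index[OF zero, of "{}"]
    by (intro row_eqI) (auto simp del: index_mult_mat)
  then show "0\<^sub>m 1 n \<in> ?N"
    unfolding prefix_module_def using zero by (intro CollectI exI[of _ 0]) simp
  fix v w assume "v \<in> ?N" "w \<in> ?N"
  then obtain P Q where P: "P \<in> nc_polys \<Sigma>" "v = lam * linear_ext n \<mu> P"
    and Q: "Q \<in> nc_polys \<Sigma>" "w = lam * linear_ext n \<mu> Q"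
    by (auto simp: prefix_module_def)
  let ?W = "Poly_Mapping.keys P \<union> Poly_Mapping.keys Q"
  have sub: "Poly_Mapping.keys (P + Q) \<subseteq> ?W"
    by (rule Poly_Mapping.keys_add)
  then have PQ: "P + Q \<in> nc_polys \<Sigma>"
    using P Q by (auto simp: nc_polys_def)
  note i = lam_linear_ext_index[of _ ?W]
  have "v + w = lam * linear_ext n \<mu> (P + Q)"
    unfolding P(2) Q(2)
  proof (rule row_eqI)
    fix k assume k: "k < n"
    have "(lam * linear_ext n \<mu> P + lam * linear_ext n \<mu> Q) $$ (0, k)
        = (lam * linear_ext n \<mu> P) $$ (0, k) + (lam * linear_ext n \<mu> Q) $$ (0, k)"
      using lam_linear_ext_carrier[OF Q(1)] k by (intro index_add_mat(1)) auto
    then show "(lam * linear_ext n \<mu> P + lam * linear_ext n \<mu> Q) $$ (0, k)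
        = (lam * linear_ext n \<mu> (P + Q)) $$ (0, k)"
      using i[OF P(1) _ _ k] i[OF Q(1) _ _ k] i[OF PQ _ sub k]
      by (simp add: lookup_add distrib_right sum.distrib del: index_mult_mat)
  qed (intro add_carrier_mat lam_linear_ext_carrier P Q PQ)+
  then show "v + w \<in> ?N"
    using PQ by (auto simp: prefix_module_def)
next
  let ?N = "prefix_module n \<Sigma> lam \<mu>"
  fix c v assume "v \<in> ?N"
  then obtain P where P: "P \<in> nc_polys \<Sigma>" "v = lam * linear_ext n \<mu> P"
    by (auto simp: prefix_module_def)
  let ?W = "Poly_Mapping.keys P" and ?Q = "Poly_Mapping.map ((*) c) P"
  have l: "Poly_Mapping.lookup ?Q w = c * Poly_Mapping.lookup P w" for w
    by (simp add: Poly_Mapping.map.rep_eq when_def)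
  have sub: "Poly_Mapping.keys ?Q \<subseteq> ?W"
    by (auto simp: in_keys_iff l)
  then have Q: "?Q \<in> nc_polys \<Sigma>"
    using P by (auto simp: nc_polys_def)
  note i = lam_linear_ext_index[of _ ?W]
  have "c \<cdot>\<^sub>m v = lam * linear_ext n \<mu> ?Q"
    unfolding P(2)
  proof (rule row_eqI)
    fix k assume k: "k < n"
    show "(c \<cdot>\<^sub>m (lam * linear_ext n \<mu> P)) $$ (0, k) = (lam * linear_ext n \<mu> ?Q) $$ (0, k)"
      using smult_mat_index[OF lam_linear_ext_carrier[OF P(1)] _ k, of 0 c]
        i[OF P(1) _ _ k] i[OF Q _ sub k]
      by (simp add: l sum_distrib_left mult.assoc del: index_mult_mat index_smult_mat)
  qed (intro smult_carrier_mat lam_linear_ext_carrier P Q)+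
  then show "c \<cdot>\<^sub>m v \<in> ?N"
    using Q by (auto simp: prefix_module_def)
qed

lemma row_of_in_prefix_module:
  assumes "w \<in> lists \<Sigma>"
  shows "row_of w \<in> prefix_module n \<Sigma> lam \<mu>"
proof -
  let ?P = "Poly_Mapping.single w (1 :: 'a)"
  have P: "?P \<in> nc_polys \<Sigma>"
    using assms by (simp add: nc_polys_def)
  have "row_of w = lam * linear_ext n \<mu> ?P"
    using row_of_carrier[OF assms] lam_linear_ext_carrier[OF P] lam_linear_ext_index[OF P, of "{w}"]
    by (intro row_eqI) (auto simp del: index_mult_mat)
  then show ?thesis
    using P by (auto simp: prefix_module_def)
qed

text \<open>This replaces polynomials by words: from here on only the rows of single words matter.\<close>

lemma prefix_module_eq_row_span:
  "prefix_module n \<Sigma> lam \<mu> = row_span n (row_of ` lists \<Sigma>)"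
proof
  have S: "submodule class_ring (row_span n (row_of ` lists \<Sigma>)) (module_mat TYPE('a) 1 n)"
    by (intro submodule_row_span rows_carrier) simp
  have sup: "row_of ` lists \<Sigma> \<subseteq> row_span n (row_of ` lists \<Sigma>)"
    by (intro row_span_superset rows_carrier) simp
  show "prefix_module n \<Sigma> lam \<mu> \<subseteq> row_span n (row_of ` lists \<Sigma>)"
  proof
    fix v assume "v \<in> prefix_module n \<Sigma> lam \<mu>"
    then obtain P where P: "P \<in> nc_polys \<Sigma>" "v = lam * linear_ext n \<mu> P"
      by (auto simp: prefix_module_def)
    show "v \<in> row_span n (row_of ` lists \<Sigma>)"
      unfolding P(2) lam_linear_ext[OF P(1)]
      by (intro finsum_mat_in_submodule[OF S] submodule_matD(4)[OF S])
        (use sup P(1) in \<open>auto simp: nc_polys_def\<close>)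
  qed
  show "row_span n (row_of ` lists \<Sigma>) \<subseteq> prefix_module n \<Sigma> lam \<mu>"
    using row_of_in_prefix_module
    by (intro row_span_least submodule_prefix_module) auto
qed

text \<open>The hypotheses make the span of the rows of \<open>X\<close> stable under right multiplication by the
  generators \<open>\<mu> [a]\<close>, since it suffices to test this on the spanning rows. Reading a word letter by
  letter, starting from the row of the empty word, then never leaves the span.\<close>

lemma row_span_eq_prefix_moduleI:
  assumes X: "X \<subseteq> lists \<Sigma>" and Nil: "row_of [] \<in> row_span n (row_of ` X)"
    and snoc: "\<And>x a. x \<in> X \<Longrightarrow> a \<in> \<Sigma> \<Longrightarrow> row_of (x @ [a]) \<in> row_span n (row_of ` X)"
  shows "row_span n (row_of ` X) = prefix_module n \<Sigma> lam \<mu>"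
proof -
  let ?S = "row_span n (row_of ` X)"
  note S = submodule_row_span[OF rows_carrier[OF X]]
  note D = submodule_matD[OF S]
  have closed: "v * \<mu> [a] \<in> ?S" if "v \<in> ?S" and a: "a \<in> \<Sigma>" for v a
  proof -
    \<comment> \<open>The rows that \<open>\<mu> [a]\<close> maps into the span form a submodule, so it suffices to check generators.\<close>
    let ?N = "{v \<in> carrier_mat 1 n. v * \<mu> [a] \<in> ?S}"
    have m: "\<mu> [a] \<in> carrier_mat n n"
      using a by (intro mu_carrier) simp
    have "submodule class_ring ?N (module_mat TYPE('a) 1 n)"
      using D(2-4) m
      by (intro submodule_matI)
        (auto simp: add_mult_distrib_mat[of _ 1 n _ "\<mu> [a]"] mult_smult_assoc_mat[of _ 1 n])
    moreover have "row_of ` X \<subseteq> ?N"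
      using X a row_of_carrier snoc by (auto simp: row_of_snoc[symmetric] subset_iff)
    ultimately have "?S \<subseteq> ?N"
      by (intro row_span_least)
    then show ?thesis
      using that by auto
  qed
  have "row_of w \<in> ?S" if "w \<in> lists \<Sigma>" for w
    using that
  proof (induction w rule: rev_induct)
    case Nil
    show ?case by (rule assms(2))
  next
    case (snoc a w)
    then show ?case
      using closed[of "row_of w" a] row_of_snoc[of w a] by auto
  qed
  then have "row_span n (row_of ` lists \<Sigma>) \<subseteq> ?S"
    by (intro row_span_least S) auto
  moreover have "?S \<subseteq> row_span n (row_of ` lists \<Sigma>)"
    using X by (intro row_span_mono image_mono)
  ultimately show ?thesis
    unfolding prefix_module_eq_row_span by blast
qed

section \<open>One iteration of the algorithm\<close>

text \<open>With \<open>c x = \<alpha> * d x\<close> the relation reads \<open>\<alpha>\<close> times the row of \<open>y\<close> equals \<open>\<alpha>\<close> times a combination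
  of rows of \<open>X\<close>, and the nonzero factor \<open>\<alpha>\<close> cancels in a domain.\<close>

lemma row_in_span_if_divisible:
  assumes X: "finite X" "X \<subseteq> lists \<Sigma>" and y: "y \<in> lists \<Sigma>"
    and "has_divisible_relation n lam \<mu> X y"
  shows "row_of y \<in> row_span n (row_of ` X)"
proof -
  obtain \<alpha> c where \<alpha>: "\<alpha> \<noteq> 0" and rel: "row_relation n lam \<mu> X y \<alpha> c"
    and "\<forall>x\<in>X. \<alpha> dvd c x"
    using assms(4) unfolding has_divisible_relation_def by blast
  then obtain d where d: "\<And>x. x \<in> X \<Longrightarrow> c x = \<alpha> * d x"
    unfolding dvd_def by metis
  have "row_relation n lam \<mu> X y 1 d"
    unfolding row_relation_iff[OF X y]
  proof (intro allI impI)
    fix k assume "k < n"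
    then have "\<alpha> * row_of y $$ (0, k) = (\<Sum>x\<in>X. c x * row_of x $$ (0, k))"
      using rel by (simp only: row_relation_iff[OF X y])
    also have "\<dots> = \<alpha> * (\<Sum>x\<in>X. d x * row_of x $$ (0, k))"
      by (simp add: sum_distrib_left d mult.assoc del: index_mult_mat)
    finally show "1 * row_of y $$ (0, k) = (\<Sum>x\<in>X. d x * row_of x $$ (0, k))"
      using \<alpha> by (simp del: index_mult_mat)
  qed
  moreover have "1 \<cdot>\<^sub>m row_of y = row_of y"
    using row_of_carrier[OF y] by (intro eq_matI) auto
  ultimately have eq: "row_of y = (\<Oplus>\<^bsub>module_mat TYPE('a) 1 n\<^esub> x \<in> X. d x \<cdot>\<^sub>m row_of x)"
    by (simp add: row_relation_def)
  note S = submodule_row_span[OF rows_carrier[OF X(2)]]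
  show ?thesis
    unfolding eq using row_span_superset[OF rows_carrier[OF X(2)]]
    by (intro finsum_mat_in_submodule[OF S X(1)] submodule_matD(4)[OF S]) auto
qed

text \<open>A relation on \<open>insert y I\<close> with nonzero coefficient at \<open>y\<close> could be solved for a nonzero multiple of
  the row of \<open>y\<close>, which is excluded; so the coefficient at \<open>y\<close> is zero and the rest is a relation
  on \<open>I\<close>.\<close>

lemma row_indep_dom_insert:
  assumes X: "finite X" "X \<subseteq> lists \<Sigma>" and y: "y \<in> lists \<Sigma>"
    and none: "\<not> has_relation n lam \<mu> X y"
    and "I \<subseteq> X" and indep: "row_indep_dom n row_of I"
  shows "row_indep_dom n row_of (insert y I)"
  unfolding row_indep_dom_def
proof (intro allI impI, elim conjE)
  fix J and c :: "'b list \<Rightarrow> 'a"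
  assume J: "finite J" "J \<subseteq> insert y I"
    and rel: "\<forall>k<n. (\<Sum>x\<in>J. c x * row_of x $$ (0, k)) = 0"
  have split: "(\<Sum>x\<in>J. c x * row_of x $$ (0, k))
      = (if y \<in> J then c y * row_of y $$ (0, k) else 0)
        + (\<Sum>x\<in>J - {y}. c x * row_of x $$ (0, k))" for k
    using J(1) by (simp add: sum.remove del: index_mult_mat)
  have cy: "c y = 0" if "y \<in> J"
  proof (rule ccontr)
    assume "c y \<noteq> 0"
    \<comment> \<open>The relation is moved to the other side and extended by zero from \<open>J - {y}\<close> to all of \<open>X\<close>.\<close>
    let ?c = "\<lambda>x. if x \<in> J - {y} then - c x else 0"
    have "c y * row_of y $$ (0, k) = (\<Sum>x\<in>X. ?c x * row_of x $$ (0, k))" if k: "k < n" for k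
    proof -
      have "c y * row_of y $$ (0, k) = - (\<Sum>x\<in>J - {y}. c x * row_of x $$ (0, k))"
        using rel k split[of k] \<open>y \<in> J\<close> by (simp add: eq_neg_iff_add_eq_0 del: index_mult_mat)
      also have "\<dots> = (\<Sum>x\<in>J - {y}. ?c x * row_of x $$ (0, k))"
        by (simp add: sum_negf del: index_mult_mat)
      also have "\<dots> = (\<Sum>x\<in>X. ?c x * row_of x $$ (0, k))"
        using J \<open>I \<subseteq> X\<close> X(1) by (intro sum.mono_neutral_left) auto
      finally show ?thesis .
    qed
    then have "row_relation n lam \<mu> X y (c y) ?c"
      unfolding row_relation_iff[OF X y] by blast
    with none \<open>c y \<noteq> 0\<close> show False
      unfolding has_relation_def by blast
  qed
  have "\<forall>k<n. (\<Sum>x\<in>J - {y}. c x * row_of x $$ (0, k)) = 0"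
    using rel cy by (auto simp: split simp del: index_mult_mat split: if_splits)
  moreover have "finite (J - {y})" "J - {y} \<subseteq> I"
    using J by auto
  ultimately have "\<forall>x\<in>J - {y}. c x = 0"
    using indep unfolding row_indep_dom_def by blast
  with cy show "\<forall>x\<in>J. c x = 0"
    by blast
qed

text \<open>The last two conjuncts say that the set \<open>X\<close> is closed up to pending work: what the span lacks to be
  stable under the letters is still listed in \<open>Y\<close>. At termination they are the hypotheses of
  \<open>row_span_eq_prefix_moduleI\<close>. Finiteness of \<open>X\<close> is carried along because a module sum over an
  infinite index set is zero by convention, so that a relation would lose its meaning.\<close>

definition prefix_invariant :: "'b list set \<times> 'b list set \<times> 'b list set \<Rightarrow> bool" where
  "prefix_invariant = (\<lambda>(X, Y, Z).
     finite X \<and> X \<subseteq> lists \<Sigma> \<and> Y \<subseteq> lists \<Sigma> \<and> row_indep_dom n row_of (X - Z)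
     \<and> ([] \<in> Y \<or> row_of [] \<in> row_span n (row_of ` X))
     \<and> (\<forall>x\<in>X. \<forall>a\<in>\<Sigma>. x @ [a] \<in> Y \<or> row_of (x @ [a]) \<in> row_span n (row_of ` X)))"

lemma prefix_invariant_initial: "prefix_invariant ({}, {[]}, {})"
  by (simp add: prefix_invariant_def row_indep_dom_def)

text \<open>Common to the two cases in which \<open>y\<close> joins \<open>X\<close>; they differ only in \<open>Z'\<close>, hence only in the
  reason for independence. Removing \<open>y\<close> from \<open>Y\<close> is harmless because its row is now a
  spanning row, and its one-letter extensions are waiting.\<close>

lemma prefix_invariant_extend:
  assumes inv: "prefix_invariant (X, Y, Z)" and y: "y \<in> Y"
    and indep: "row_indep_dom n row_of (X \<union> {y} - Z')"
  shows "prefix_invariant (X \<union> {y}, (Y \<union> (\<lambda>a. y @ [a]) ` \<Sigma>) - {y}, Z')"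
proof -
  have X: "finite X" "X \<subseteq> lists \<Sigma>" and Y: "Y \<subseteq> lists \<Sigma>"
    and Nil: "[] \<in> Y \<or> row_of [] \<in> row_span n (row_of ` X)"
    and snoc: "\<forall>x\<in>X. \<forall>a\<in>\<Sigma>. x @ [a] \<in> Y \<or> row_of (x @ [a]) \<in> row_span n (row_of ` X)"
    using inv by (simp_all add: prefix_invariant_def)
  have Xy: "X \<union> {y} \<subseteq> lists \<Sigma>"
    using X Y y by auto
  have mono: "row_span n (row_of ` X) \<subseteq> row_span n (row_of ` (X \<union> {y}))"
    by (intro row_span_mono) auto
  have y_span: "row_of y \<in> row_span n (row_of ` (X \<union> {y}))"
    using row_span_superset[OF rows_carrier[OF Xy]] by auto
  let ?Y = "Y \<union> (\<lambda>a. y @ [a]) ` \<Sigma> - {y}" and ?S = "row_span n (row_of ` (X \<union> {y}))"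
  have stay: "w \<in> ?Y \<or> row_of w \<in> ?S"
    if "w \<in> Y \<union> (\<lambda>a. y @ [a]) ` \<Sigma> \<or> row_of w \<in> row_span n (row_of ` X)" for w
    using that mono y_span by (cases "w = y") auto
  have "[] \<in> ?Y \<or> row_of [] \<in> ?S"
    using Nil by (intro stay) blast
  moreover have "\<forall>x\<in>X \<union> {y}. \<forall>a\<in>\<Sigma>. x @ [a] \<in> ?Y \<or> row_of (x @ [a]) \<in> ?S"
    using snoc by (intro ballI stay) blast
  moreover have "?Y \<subseteq> lists \<Sigma>"
    using Xy Y by (auto dest: subsetD)
  ultimately show ?thesis
    unfolding prefix_invariant_def using X(1) Xy indep
    by (simp del: index_mult_mat Un_insert_right Un_iff)
qed

lemma prefix_invariant_discard:
  assumes inv: "prefix_invariant (X, Y, Z)" and y: "y \<in> Y"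
    and div: "has_divisible_relation n lam \<mu> X y"
  shows "prefix_invariant (X, Y - {y}, Z)"
proof -
  have "row_of y \<in> row_span n (row_of ` X)"
    using inv y div by (intro row_in_span_if_divisible) (auto simp: prefix_invariant_def)
  then show ?thesis
    using inv unfolding prefix_invariant_def by auto
qed

lemma prefix_invariant_step:
  assumes "prefix_step n \<Sigma> lam \<mu> s s'" and "prefix_invariant s"
  shows "prefix_invariant s'"
  using assms
proof (induction rule: prefix_step.induct)
  case (independent y Y X Z)
  then have "row_indep_dom n row_of (insert y (X - Z))"
    by (intro row_indep_dom_insert[of X]) (auto simp: prefix_invariant_def)
  then have "row_indep_dom n row_of (X \<union> {y} - Z)"
    by (rule row_indep_dom_subset) auto
  with independent show ?case
    by (intro prefix_invariant_extend)
next
  case (divisible y Y X Z)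
  then show ?case
    by (intro prefix_invariant_discard)
next
  case (dependent y Y X Z)
  \<comment> \<open>The word \<open>y\<close> joins both \<open>X\<close> and \<open>Z\<close>, so \<open>X - Z\<close> does not grow.\<close>
  then have "row_indep_dom n row_of (X - Z)"
    by (simp add: prefix_invariant_def)
  then have "row_indep_dom n row_of (X \<union> {y} - (Z \<union> {y}))"
    by (rule row_indep_dom_subset) auto
  with dependent show ?case
    by (intro prefix_invariant_extend)
qed

lemma prefix_invariant_output:
  assumes "prefix_output n \<Sigma> lam \<mu> X Z"
  shows "prefix_invariant (X, {}, Z)"
proof -
  have "prefix_invariant s'" if "(prefix_step n \<Sigma> lam \<mu>)\<^sup>*\<^sup>* s s'" and "prefix_invariant s" for s s'
    using that by (induction rule: rtranclp_induct) (blast intro: prefix_invariant_step)+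
  then show ?thesis
    using assms prefix_invariant_initial unfolding prefix_output_def by blast
qed

end

section \<open>Correctness of the output\<close>

theorem proposition1:
  fixes n :: nat
    and \<Sigma> :: "'b set"
    and lam :: "'a :: idom mat"
    and \<mu> :: "'b list \<Rightarrow> 'a mat"
    and \<gamma> :: "'a mat"
    and X Z :: "'b list set"
  assumes "finite \<Sigma>"
    and "linear_representation n \<Sigma> lam \<mu> \<gamma>"
    and "prefix_output n \<Sigma> lam \<mu> X Z"
  shows "row_span n ((\<lambda>x. lam * \<mu> x) ` X) = prefix_module n \<Sigma> lam \<mu>
    \<and> row_indep_family n (\<lambda>x. map_mat to_fract (lam * \<mu> x) :: 'a fract mat) (X - Z)"
proof -
  interpret linear_representation n \<Sigma> lam \<mu> \<gamma>
    by fact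
  have inv: "prefix_invariant (X, {}, Z)"
    using assms(3) by (rule prefix_invariant_output)
  then have X: "X \<subseteq> lists \<Sigma>" and indep: "row_indep_dom n row_of (X - Z)"
    by (auto simp: prefix_invariant_def)
  have "row_span n (row_of ` X) = prefix_module n \<Sigma> lam \<mu>"
    using inv X by (intro row_span_eq_prefix_moduleI) (auto simp: prefix_invariant_def)
  moreover have "row_indep_family n (\<lambda>x. map_mat to_fract (row_of x) :: 'a fract mat) (X - Z)"
    using indep X row_of_carrier by (intro row_indep_family_fract) blast+
  ultimately show ?thesis
    by blast
qed

end
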